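(* Let $\Psi=(S,C,F)$ be a proper monotonic expansion system, and give $S_0$ the order topology. Then $\Psi$ is accurate if and only if $\Psi$ is separating.
   Context: $\mathbb N=\{0,1,2,\dots\}$. An expansion system $\Psi=(S,C,F)$ consists of sets $S_i$ ($i\in\mathbb N$), each with a distinguished neutral element $\nu_i\in S_i$, sets $C_i$ ($i\in\mathbb N$), and maps $P_i\colon S_i\to C_i$ and $E_i\colon S_i\to S_{i+1}$ such that $E_i(\nu_i)=\nu_{i+1}$ and $F_i=(P_i,E_i)\colon S_i\to C_i\times S_{i+1}$ is injective, for all $i$. For $y\in S_0$ put $y_0=y$, $y_{i+1}=E_i(y_i)$, $\hat P_i(y)=c_i=P_i(y_i)$. Put $\hat C=\prod_{i\in\mathbb N}C_i$ and $\hat P\colon S_0\to\hat C$, $\hat P(y)=(c_0,c_1,\dots)$. $\Psi$ is separating if $\hat P$ is injective. Properness and convergents: given $y\in S_0$ with coefficients $c_i$ and $n\in\mathbb N$, set $y^{[n]}_n=\nu_n$ and, for $i=n-1,\dots,0$, $y^{[n]}_i=F_i^{-1}(c_i,y^{[n]}_{i+1})$, provided $(c_i,y^{[n]}_{i+1})\in F_i(S_i)$. If this proviso holds at every step, $\Psi$ is called proper at order $n$ with respect to $y$, and $y^{[n]}:=y^{[n]}_0$ is the $n$-th convergent of $y$. $\Psi$ is proper if it is proper at every order with respect to every $y\in S_0$. $\Psi$ is accurate if for every $y\in S_0$ the sequence $(y^{[n]})_n$ converges to $y$ in the topology of $S_0$. $\Psi$ is monotonic if all $S_i$ and $C_i$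 are linearly ordered sets and each $F_i\colon S_i\to C_i\times S_{i+1}$ is either strictly increasing or strictly decreasing (depending on $i$), where $C_i\times S_{i+1}$ has the dictionary (lexicographic) order. The order topology on a linearly ordered set is the one generated by the open rays. *)

theory Defs
  imports "HOL-Analysis.Analysis"
begin

text \<open>The sets \<open>S\<^sub>i\<close> (and likewise the sets \<open>C\<^sub>i\<close>) all live in one type; this is no
  restriction, since any sequence of sets embeds into the type of its disjoint union.\<close>

record ('s, 'c) exp_sys =
  Sset :: "nat \<Rightarrow> 's set"
  Cset :: "nat \<Rightarrow> 'c set"
  neutral :: "nat \<Rightarrow> 's"
  Pmap :: "nat \<Rightarrow> 's \<Rightarrow> 'c"
  Emap :: "nat \<Rightarrow> 's \<Rightarrow> 's"

definition Fmap :: "('s, 'c) exp_sys \<Rightarrow> nat \<Rightarrow> 's \<Rightarrow> 'c \<times> 's" where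
  "Fmap \<Psi> i x = (Pmap \<Psi> i x, Emap \<Psi> i x)"

definition expansion_system :: "('s, 'c) exp_sys \<Rightarrow> bool" where
  "expansion_system \<Psi> \<longleftrightarrow>
     (\<forall>i. neutral \<Psi> i \<in> Sset \<Psi> i) \<and>
     (\<forall>i. Pmap \<Psi> i \<in> Sset \<Psi> i \<rightarrow> Cset \<Psi> i) \<and>
     (\<forall>i. Emap \<Psi> i \<in> Sset \<Psi> i \<rightarrow> Sset \<Psi> (Suc i)) \<and>
     (\<forall>i. Emap \<Psi> i (neutral \<Psi> i) = neutral \<Psi> (Suc i)) \<and>
     (\<forall>i. inj_on (Fmap \<Psi> i) (Sset \<Psi> i))"

primrec remainder :: "('s, 'c) exp_sys \<Rightarrow> 's \<Rightarrow> nat \<Rightarrow> 's" where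
  "remainder \<Psi> y 0 = y"
| "remainder \<Psi> y (Suc i) = Emap \<Psi> i (remainder \<Psi> y i)"

definition coefficients :: "('s, 'c) exp_sys \<Rightarrow> 's \<Rightarrow> nat \<Rightarrow> 'c" where
  "coefficients \<Psi> y i = Pmap \<Psi> i (remainder \<Psi> y i)"

definition separating :: "('s, 'c) exp_sys \<Rightarrow> bool" where
  "separating \<Psi> \<longleftrightarrow> inj_on (coefficients \<Psi>) (Sset \<Psi> 0)"

text \<open>\<open>partial_convergent \<Psi> y n i\<close> is \<open>y\<^sup>[\<^sup>n\<^sup>]\<^sub>i\<close> for \<open>i \<le> n\<close>. It carries meaning only when
  the proviso stated in \<open>proper_at\<close> holds, since otherwise \<open>inv_into\<close> returns an arbitrary value;
  its value for \<open>i > n\<close> is a dummy that is never used.\<close>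

function partial_convergent :: "('s, 'c) exp_sys \<Rightarrow> 's \<Rightarrow> nat \<Rightarrow> nat \<Rightarrow> 's" where
  "partial_convergent \<Psi> y n i =
     (if i < n
      then inv_into (Sset \<Psi> i) (Fmap \<Psi> i)
             (coefficients \<Psi> y i, partial_convergent \<Psi> y n (Suc i))
      else neutral \<Psi> n)"
  by pat_completeness auto
termination
  by (relation "Wellfounded.measure (\<lambda>(\<Psi>, y, n, i). n - i)") auto

declare partial_convergent.simps [simp del]

definition proper_at :: "('s, 'c) exp_sys \<Rightarrow> nat \<Rightarrow> 's \<Rightarrow> bool" where
  "proper_at \<Psi> n y \<longleftrightarrow>
     (\<forall>i<n. (coefficients \<Psi> y i, partial_convergent \<Psi> y n (Suc i)) \<in> Fmap \<Psi> i ` Sset \<Psi> i)"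

definition proper :: "('s, 'c) exp_sys \<Rightarrow> bool" where
  "proper \<Psi> \<longleftrightarrow> (\<forall>n. \<forall>y\<in>Sset \<Psi> 0. proper_at \<Psi> n y)"

definition nth_convergent :: "('s, 'c) exp_sys \<Rightarrow> 's \<Rightarrow> nat \<Rightarrow> 's" where
  "nth_convergent \<Psi> y n = partial_convergent \<Psi> y n 0"

definition accurate :: "('s, 'c) exp_sys \<Rightarrow> 's topology \<Rightarrow> bool" where
  "accurate \<Psi> T \<longleftrightarrow> (\<forall>y\<in>Sset \<Psi> 0. limitin T (nth_convergent \<Psi> y) y sequentially)"

definition strict_of :: "'a rel \<Rightarrow> 'a \<Rightarrow> 'a \<Rightarrow> bool" where
  "strict_of r x y \<longleftrightarrow> (x, y) \<in> r - Id"

definition strict_lex :: "'a rel \<Rightarrow> 'b rel \<Rightarrow> 'a \<times> 'b \<Rightarrow> 'a \<times> 'b \<Rightarrow> bool" where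
  "strict_lex r s p q \<longleftrightarrow> (p, q) \<in> (r - Id) <*lex*> (s - Id)"

definition monotonic ::
  "('s, 'c) exp_sys \<Rightarrow> (nat \<Rightarrow> 's rel) \<Rightarrow> (nat \<Rightarrow> 'c rel) \<Rightarrow> bool" where
  "monotonic \<Psi> leS leC \<longleftrightarrow>
     (\<forall>i. linear_order_on (Sset \<Psi> i) (leS i)) \<and>
     (\<forall>i. linear_order_on (Cset \<Psi> i) (leC i)) \<and>
     (\<forall>i. monotone_on (Sset \<Psi> i) (strict_of (leS i))
             (strict_lex (leC i) (leS (Suc i))) (Fmap \<Psi> i) \<or>
          monotone_on (Sset \<Psi> i) (strict_of (leS i))
             (strict_lex (leC i) (leS (Suc i)))\<inverse>\<inverse> (Fmap \<Psi> i))"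

text \<open>\<open>A\<close> itself is among the generators because, for a one-point \<open>A\<close>, the open rays do not cover
  \<open>A\<close>, and \<open>topspace (topology_generated_by \<U>)\<close> is the union of \<open>\<U>\<close>.\<close>

definition order_topology_on :: "'a set \<Rightarrow> 'a rel \<Rightarrow> 'a topology" where
  "order_topology_on A r = topology_generated_by
     (insert A ((\<lambda>a. {x\<in>A. strict_of r a x}) ` A \<union> (\<lambda>a. {x\<in>A. strict_of r x a}) ` A))"

end

theory Submission
  imports Defs
begin

text \<open>The \<open>n\<close>-th convergent of \<open>y\<close> is determined by the coefficients of \<open>y\<close> and shares the first
  \<open>n\<close> of them. Points with equal coefficients thus have equal convergents, and limits in the
  order topology are unique, so accuracy forces separation. Conversely, monotonicity makes the
  order on \<open>S\<^sub>0\<close> of two points depend only on their coefficients up to the first index \<open>k\<close> where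
  they differ. If \<open>a \<noteq> y\<close> and separation provides such a \<open>k\<close>, then for \<open>n > k\<close> the convergent
  \<open>y\<^sup>[\<^sup>n\<^sup>]\<close> lies on the same side of \<open>a\<close> as \<open>y\<close>.\<close>

section \<open>Order topologies\<close>

text \<open>A subbasis suffices to test convergence: the sets that contain \<open>f x\<close>
  eventually whenever they contain \<open>l\<close> are closed under finite intersections, as a
  filter is, and under arbitrary unions, as one member containing \<open>l\<close> already does the
  job.\<close>

lemma limitin_topology_generated_by:
  "limitin (topology_generated_by B) f l F \<longleftrightarrow>
     l \<in> \<Union>B \<and> (\<forall>U\<in>B. l \<in> U \<longrightarrow> (\<forall>\<^sub>F x in F. f x \<in> U))"
  (is "?lim \<longleftrightarrow> ?sub")
proof
  assume ?lim
  then show ?sub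
    unfolding limitin_def by (auto intro: topology_generated_by_Basis)
next
  assume sub: ?sub
  have "l \<in> U \<longrightarrow> (\<forall>\<^sub>F x in F. f x \<in> U)" if "generate_topology_on B U" for U
    using that
  proof (induction rule: generate_topology_on.induct)
    case (UN K)
    show ?case
    proof
      assume "l \<in> \<Union>K"
      then obtain X where X: "X \<in> K" "l \<in> X" by blast
      with UN.IH have "\<forall>\<^sub>F x in F. f x \<in> X" by blast
      then show "\<forall>\<^sub>F x in F. f x \<in> \<Union>K"
        by (rule eventually_mono) (use X in blast)
    qed
  qed (use sub in \<open>auto intro: eventually_conj\<close>)
  with sub show ?lim
    by (auto simp: limitin_def openin_topology_generated_by_iff)
qed

lemma strict_of_irrefl [simp]: "\<not> strict_of r x x"
  by (simp add: strict_of_def)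

lemma strict_of_trans:
  assumes "linear_order_on A r" "strict_of r x y" "strict_of r y z"
  shows "strict_of r x z"
proof -
  have "trans (r - Id)"
    using assms(1) by (intro trans_diff_Id) (simp_all add: order_on_defs)
  with assms(2,3) show ?thesis
    unfolding strict_of_def by (blast dest: transD)
qed

lemma strict_of_asym:
  assumes "linear_order_on A r" "strict_of r x y"
  shows "\<not> strict_of r y x"
  using strict_of_trans[OF assms, of x] by auto

lemma strict_of_total:
  assumes "linear_order_on A r" "x \<in> A" "y \<in> A" "x \<noteq> y"
  shows "strict_of r x y \<or> strict_of r y x"
  using assms unfolding order_on_defs strict_of_def total_on_def by auto

text \<open>The generator \<open>A\<close> yields the second conjunct, the two families of rays
  yield the last two. A point outside \<open>A\<close> lies in no generator, so both sides fail
  there.\<close>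

lemma limitin_order_topology_on:
  "limitin (order_topology_on A r) f l F \<longleftrightarrow>
     l \<in> A \<and> (\<forall>\<^sub>F x in F. f x \<in> A) \<and>
     (\<forall>a\<in>A. strict_of r a l \<longrightarrow> (\<forall>\<^sub>F x in F. f x \<in> A \<and> strict_of r a (f x))) \<and>
     (\<forall>a\<in>A. strict_of r l a \<longrightarrow> (\<forall>\<^sub>F x in F. f x \<in> A \<and> strict_of r (f x) a))"
proof (cases "l \<in> A")
  case True
  then show ?thesis
    by (simp add: order_topology_on_def limitin_topology_generated_by ball_Un)
next
  case False
  then show ?thesis
    by (simp add: order_topology_on_def limitin_topology_generated_by)
qed

text \<open>If x < y are both limits, the values of \<open>f\<close> eventually lie below every a >
  x and above every b < y. Using this twice avoids a case distinction on whether there is a gap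
  between x and y.\<close>

lemma limitin_order_topology_on_not_less:
  assumes lin: "linear_order_on A r" and nt: "F \<noteq> bot"
    and x: "limitin (order_topology_on A r) f x F"
    and y: "limitin (order_topology_on A r) f y F"
  shows "\<not> strict_of r x y"
proof
  assume xy: "strict_of r x y"
  have A: "x \<in> A" "y \<in> A"
    using x y by (auto simp: limitin_order_topology_on)
  have between: "\<exists>c\<in>A. strict_of r b c \<and> strict_of r c a"
    if "a \<in> A" "strict_of r x a" "b \<in> A" "strict_of r b y" for a b
  proof -
    have "\<forall>\<^sub>F i in F. (f i \<in> A \<and> strict_of r (f i) a) \<and> (f i \<in> A \<and> strict_of r b (f i))"
      by (rule eventually_conj)
        (use x y that in \<open>simp_all add: limitin_order_topology_on\<close>)
    from eventually_happens'[OF nt this] show ?thesis by blast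
  qed
  \<comment> \<open>First take a = y and b = x, which gives a point c strictly between them. Such a
    c is itself admissible both as a and as b, so the second use puts d strictly above and strictly
    below c.\<close>
  obtain c where c: "c \<in> A" "strict_of r x c" "strict_of r c y"
    using between[OF A(2) xy A(1) xy] by blast
  obtain d where "strict_of r c d" "strict_of r d c"
    using between[OF c(1,2,1,3)] by blast
  then show False
    using strict_of_asym[OF lin] by blast
qed

lemma limitin_order_topology_on_unique:
  assumes "linear_order_on A r" "F \<noteq> bot"
    and "limitin (order_topology_on A r) f x F" "limitin (order_topology_on A r) f y F"
  shows "x = y"
proof (rule ccontr)
  have "x \<in> A" "y \<in> A"
    using assms(3,4) by (simp_all add: limitin_order_topology_on)
  moreover assume "x \<noteq> y"
  ultimately show False
    using strict_of_total[OF assms(1)] limitin_order_topology_on_not_less[OF assms]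
      limitin_order_topology_on_not_less[OF assms(1,2,4,3)] by blast
qed

section \<open>Convergents\<close>

lemma partial_convergent_cong:
  assumes "coefficients \<Psi> y = coefficients \<Psi> z"
  shows "partial_convergent \<Psi> y n i = partial_convergent \<Psi> z n i"
\<comment> \<open>The recursion climbs from i to n, hence induction on the distance. By truncated
  subtraction the base case is i \<ge> n, where both sides are
  \<open>neutral \<Psi> n\<close>.\<close>
proof (induction "n - i" arbitrary: i)
  case 0
  then show ?case by (subst (1 2) partial_convergent.simps) simp
next
  case (Suc d)
  have "partial_convergent \<Psi> y n (Suc i) = partial_convergent \<Psi> z n (Suc i)"
    using Suc by simp
  then show ?case
    using assms by (subst (1 2) partial_convergent.simps) simp
qed

lemma remainder_in_Sset:
  assumes "expansion_system \<Psi>" "y \<in> Sset \<Psi> 0"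
  shows "remainder \<Psi> y i \<in> Sset \<Psi> i"
  using assms by (induction i) (auto simp: expansion_system_def)

text \<open>The proviso makes \<open>inv_into\<close> a genuine preimage, so applying
  \<open>Fmap \<Psi> i\<close> undoes one step of the backward recursion.\<close>

lemma partial_convergent_step:
  assumes "proper_at \<Psi> n y" "i < n"
  shows "partial_convergent \<Psi> y n i \<in> Sset \<Psi> i"
    and "Pmap \<Psi> i (partial_convergent \<Psi> y n i) = coefficients \<Psi> y i"
    and "Emap \<Psi> i (partial_convergent \<Psi> y n i) = partial_convergent \<Psi> y n (Suc i)"
proof -
  have img: "(coefficients \<Psi> y i, partial_convergent \<Psi> y n (Suc i)) \<in> Fmap \<Psi> i ` Sset \<Psi> i"
    using assms by (simp add: proper_at_def)
  have eq: "partial_convergent \<Psi> y n i = inv_into (Sset \<Psi> i) (Fmap \<Psi> i)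
      (coefficients \<Psi> y i, partial_convergent \<Psi> y n (Suc i))"
    using assms(2) by (subst partial_convergent.simps) simp
  show "partial_convergent \<Psi> y n i \<in> Sset \<Psi> i"
    unfolding eq by (rule inv_into_into[OF img])
  from f_inv_into_f[OF img] show
    "Pmap \<Psi> i (partial_convergent \<Psi> y n i) = coefficients \<Psi> y i"
    "Emap \<Psi> i (partial_convergent \<Psi> y n i) = partial_convergent \<Psi> y n (Suc i)"
    unfolding eq[symmetric] by (simp_all add: Fmap_def)
qed

lemma nth_convergent_in_Sset:
  assumes "expansion_system \<Psi>" "proper_at \<Psi> n y"
  shows "nth_convergent \<Psi> y n \<in> Sset \<Psi> 0"
proof (cases n)
  case 0
  \<comment> \<open>At order 0 there is no step to undo: the convergent is the neutral
    element.\<close>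
  then show ?thesis
    using assms(1)
    by (simp add: nth_convergent_def partial_convergent.simps[of _ _ 0] expansion_system_def)
next
  case Suc
  then show ?thesis
    using partial_convergent_step(1)[OF assms(2), of 0] by (simp add: nth_convergent_def)
qed

text \<open>Iterating E forward from the convergent retraces the backward recursion; this is what
  makes the first n coefficients agree with those of y.\<close>

lemma remainder_nth_convergent:
  assumes "proper_at \<Psi> n y" "i \<le> n"
  shows "remainder \<Psi> (nth_convergent \<Psi> y n) i = partial_convergent \<Psi> y n i"
  using assms(2)
  by (induction i) (simp_all add: nth_convergent_def partial_convergent_step(3)[OF assms(1)])

lemma coefficients_nth_convergent:
  assumes "proper_at \<Psi> n y" "i < n"
  shows "coefficients \<Psi> (nth_convergent \<Psi> y n) i = coefficients \<Psi> y i"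
  using assms
  by (simp add: coefficients_def remainder_nth_convergent partial_convergent_step(2))

section \<open>Monotonicity\<close>

lemma strict_lex_iff:
  "strict_lex r s p q \<longleftrightarrow>
     strict_of r (fst p) (fst q) \<or> fst p = fst q \<and> strict_of s (snd p) (snd q)"
  by (cases p; cases q) (auto simp: strict_lex_def strict_of_def)

lemma strict_lex_asym:
  assumes "linear_order_on A r" "linear_order_on B s" "strict_lex r s p q"
  shows "\<not> strict_lex r s q p"
  using assms(3) strict_of_asym[OF assms(1)] strict_of_asym[OF assms(2)]
  by (auto simp: strict_lex_iff)

text \<open>A strictly monotone map on a linear order also reflects the order: by totality the only
  alternatives are x = y and y < x, and asymmetry of \<open>R\<close> excludes both.
  \<open>R\<close> is kept general to cover the lexicographic order and its converse.\<close>

lemma monotone_on_strict_of_iff: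
  assumes "linear_order_on A r" "monotone_on A (strict_of r) R f"
    and "\<And>p q. R p q \<Longrightarrow> \<not> R q p" "x \<in> A" "y \<in> A"
  shows "R (f x) (f y) \<longleftrightarrow> strict_of r x y"
proof
  assume R: "R (f x) (f y)"
  with assms(3) have "\<not> R (f x) (f x)" "\<not> R (f y) (f x)" by blast+
  with R monotone_onD[OF assms(2,5,4)] strict_of_total[OF assms(1,4,5)]
  show "strict_of r x y" by auto
qed (rule monotone_onD[OF assms(2,4,5)])

text \<open>Stated as equivalences, the two cases reduce a comparison at level i to coefficients
  and, when these tie, to remainders at level i + 1.\<close>

lemma monotonic_cases:
  assumes "monotonic \<Psi> leS leC"
  obtains
    (increasing) "\<And>x y. x \<in> Sset \<Psi> i \<Longrightarrow> y \<in> Sset \<Psi> i \<Longrightarrow>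
      strict_of (leS i) x y \<longleftrightarrow> strict_lex (leC i) (leS (Suc i)) (Fmap \<Psi> i x) (Fmap \<Psi> i y)"
  | (decreasing) "\<And>x y. x \<in> Sset \<Psi> i \<Longrightarrow> y \<in> Sset \<Psi> i \<Longrightarrow>
      strict_of (leS i) x y \<longleftrightarrow> strict_lex (leC i) (leS (Suc i)) (Fmap \<Psi> i y) (Fmap \<Psi> i x)"
proof -
  let ?R = "strict_lex (leC i) (leS (Suc i))"
  have lin: "linear_order_on (Sset \<Psi> j) (leS j)" "linear_order_on (Cset \<Psi> j) (leC j)" for j
    using assms by (simp_all add: monotonic_def)
  note asym = strict_lex_asym[OF lin(2) lin(1)]
  from assms consider "monotone_on (Sset \<Psi> i) (strict_of (leS i)) ?R (Fmap \<Psi> i)"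
    | "monotone_on (Sset \<Psi> i) (strict_of (leS i)) ?R\<inverse>\<inverse> (Fmap \<Psi> i)"
    by (auto simp: monotonic_def)
  then show thesis
  proof cases
    case 1
    show thesis
      by (rule increasing) (simp add: monotone_on_strict_of_iff[OF lin(1) 1 asym])
  next
    case 2
    have "?R\<inverse>\<inverse> p q \<Longrightarrow> \<not> ?R\<inverse>\<inverse> q p" for p q
      using asym by auto
    from monotone_on_strict_of_iff[OF lin(1) 2 this] show thesis
      by (intro decreasing) simp
  qed
qed

text \<open>Both orientations are needed in the induction, as a decreasing step swaps them.\<close>

lemma strict_of_first_difference:
  assumes es: "expansion_system \<Psi>" and mono: "monotonic \<Psi> leS leC"
    and S: "a \<in> Sset \<Psi> 0" "y \<in> Sset \<Psi> 0" "z \<in> Sset \<Psi> 0"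
    and eq: "\<And>j. j < k \<Longrightarrow> coefficients \<Psi> a j = coefficients \<Psi> y j"
    and neq: "coefficients \<Psi> a k \<noteq> coefficients \<Psi> y k"
    and eqz: "\<And>j. j \<le> k \<Longrightarrow> coefficients \<Psi> z j = coefficients \<Psi> y j"
  shows "strict_of (leS 0) a y \<longleftrightarrow> strict_of (leS 0) a z"
    and "strict_of (leS 0) y a \<longleftrightarrow> strict_of (leS 0) z a"
proof -
  let ?a = "remainder \<Psi> a" and ?y = "remainder \<Psi> y" and ?z = "remainder \<Psi> z"
  have "(strict_of (leS i) (?a i) (?y i) \<longleftrightarrow> strict_of (leS i) (?a i) (?z i)) \<and>
      (strict_of (leS i) (?y i) (?a i) \<longleftrightarrow> strict_of (leS i) (?z i) (?a i))" if "i \<le> k" for i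
    using that
  \<comment> \<open>The induction descends from k, where the comparison is decided, to 0.\<close>
  proof (induction rule: inc_induct)
    case base
    \<comment> \<open>The coefficients of a and y differ here and z shares that of y, so the first
      lexicographic component decides alone; the later remainders of y and z may differ.\<close>
    show ?case
      using mono neq eqz[of k]
      by (cases rule: monotonic_cases[where i = k])
        (auto simp: strict_lex_iff Fmap_def coefficients_def remainder_in_Sset[OF es] S)
  next
    case (step i)
    \<comment> \<open>Below k all three coefficients agree, so the comparison passes to the next
      remainders.\<close>
    show ?case
      using mono step eq[of i] eqz[of i]
      by (cases rule: monotonic_cases[where i = i])
        (auto simp: strict_lex_iff Fmap_def coefficients_def remainder_in_Sset[OF es] S)
  qed
  from this[of 0] show "strict_of (leS 0) a y \<longleftrightarrow> strict_of (leS 0) a z"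
    and "strict_of (leS 0) y a \<longleftrightarrow> strict_of (leS 0) z a"
    by simp_all
qed

theorem theorem3p22:
  fixes \<Psi> :: "('s, 'c) exp_sys"
    and leS :: "nat \<Rightarrow> 's rel"
    and leC :: "nat \<Rightarrow> 'c rel"
  assumes "expansion_system \<Psi>"
    and "proper \<Psi>"
    and "monotonic \<Psi> leS leC"
  shows "accurate \<Psi> (order_topology_on (Sset \<Psi> 0) (leS 0)) \<longleftrightarrow> separating \<Psi>"
proof
  have lin: "linear_order_on (Sset \<Psi> 0) (leS 0)"
    using assms(3) by (simp add: monotonic_def)
  assume acc: "accurate \<Psi> (order_topology_on (Sset \<Psi> 0) (leS 0))"
  show "separating \<Psi>"
    unfolding separating_def
  proof (rule inj_onI)
    fix y z
    assume yz: "y \<in> Sset \<Psi> 0" "z \<in> Sset \<Psi> 0" "coefficients \<Psi> y = coefficients \<Psi> z"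
    then have "nth_convergent \<Psi> y = nth_convergent \<Psi> z"
      by (intro ext, simp add: nth_convergent_def partial_convergent_cong[of \<Psi> y z])
    with acc yz show "y = z"
      unfolding accurate_def
      by (auto intro: limitin_order_topology_on_unique[OF lin sequentially_bot])
  qed
next
  assume sep: "separating \<Psi>"
  have proper: "proper_at \<Psi> n y" if "y \<in> Sset \<Psi> 0" for n y
    using assms(2) that by (simp add: proper_def)
  have side: "\<forall>\<^sub>F n in sequentially.
      (strict_of (leS 0) a y \<longleftrightarrow> strict_of (leS 0) a (nth_convergent \<Psi> y n)) \<and>
      (strict_of (leS 0) y a \<longleftrightarrow> strict_of (leS 0) (nth_convergent \<Psi> y n) a)"
    if ay: "a \<in> Sset \<Psi> 0" "y \<in> Sset \<Psi> 0" "a \<noteq> y" for a y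
  proof -
    have "\<exists>k. coefficients \<Psi> a k \<noteq> coefficients \<Psi> y k"
      using sep ay by (auto simp: separating_def dest: inj_onD)
    then obtain k where k: "coefficients \<Psi> a k \<noteq> coefficients \<Psi> y k"
      "\<And>j. j < k \<Longrightarrow> coefficients \<Psi> a j = coefficients \<Psi> y j"
      using exists_least_iff[of "\<lambda>k. coefficients \<Psi> a k \<noteq> coefficients \<Psi> y k"] by blast
    show ?thesis
      \<comment> \<open>Agreement is needed at all indices up to and including k, while the
        convergent of order n guarantees it only below n; hence n > k.\<close>
      using eventually_gt_at_top[of k]
    proof eventually_elim
      case (elim n)
      then show ?case
        using strict_of_first_difference[OF assms(1,3) ay(1,2)
            nth_convergent_in_Sset[OF assms(1) proper[OF ay(2)]] k(2,1), of n]
          coefficients_nth_convergent[OF proper[OF ay(2)]]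
        by auto
    qed
  qed
  show "accurate \<Psi> (order_topology_on (Sset \<Psi> 0) (leS 0))"
    \<comment> \<open>Only rays with endpoint a remain to be checked. If such a ray contains y, then
      a \<noteq> y by irreflexivity, and \<open>side\<close> applies.\<close>
    unfolding accurate_def limitin_order_topology_on
  proof (intro ballI conjI impI)
    fix y a
    assume y: "y \<in> Sset \<Psi> 0"
    have S: "nth_convergent \<Psi> y n \<in> Sset \<Psi> 0" for n
      by (rule nth_convergent_in_Sset[OF assms(1) proper[OF y]])
    show "y \<in> Sset \<Psi> 0" by fact
    show "\<forall>\<^sub>F n in sequentially. nth_convergent \<Psi> y n \<in> Sset \<Psi> 0"
      by (simp add: S)
    assume a: "a \<in> Sset \<Psi> 0"
    show "\<forall>\<^sub>F n in sequentially. nth_convergent \<Psi> y n \<in> Sset \<Psi> 0 \<and>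
        strict_of (leS 0) a (nth_convergent \<Psi> y n)" if "strict_of (leS 0) a y"
    proof -
      from that have "a \<noteq> y" by auto
      from side[OF a y this] show ?thesis
        by (rule eventually_mono) (use S that in simp)
    qed
    show "\<forall>\<^sub>F n in sequentially. nth_convergent \<Psi> y n \<in> Sset \<Psi> 0 \<and>
        strict_of (leS 0) (nth_convergent \<Psi> y n) a" if "strict_of (leS 0) y a"
    proof -
      from that have "a \<noteq> y" by auto
      from side[OF a y this] show ?thesis
        by (rule eventually_mono) (use S that in simp)
    qed
  qed
qed

end
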